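(* Let $\Omega\subset\mathbb{C}$ be a simply-connected domain. Suppose $$T(z) = A - zI + E(z), \qquad z\in\Omega,$$ is regular, where $A \in \mathbb{C}^{n \times n}$ has a complete basis of eigenvectors $V \in \mathbb{C}^{n \times n}$ and $E : \Omega \to \mathbb{C}^{n \times n}$ is analytic. Suppose also that $|E(z)| \le F$ componentwise for all $z \in \Omega$, where $F\in\mathbb{R}^{n\times n}$. Then the eigenvalues of $T$ in $\Omega$ lie in the union of disks $$\bigcup_{i=1}^n \{ z \in \mathbb{C} : |z-\lambda_i| \le \phi_i \}, \qquad \phi_i = n\|F\|_2 \sec(\theta_i),$$ where $(\lambda_i, w_i, v_i)$, $i=1,\dots,n$, are the eigentriples of $A$ and $\theta_i$ is the angle between the left and right eigenvectors $w_i$ and $v_i$. If $\mathcal{U}$ is a union of any $k$ of these disks that are disjoint from the remaining disks, and if $\mathcal{U} \subset \Omega$, then $\mathcal{U}$ contains exactly $k$ eigenvalues of $T$, counting multiplicity.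
   Context: An analytic $T:\Omega\to\mathbb{C}^{n\times n}$ is regular if $\det T(z)\not\equiv 0$ on $\Omega$. A point $\lambda\in\Omega$ is an eigenvalue of $T$ if $T(\lambda)$ is singular; its multiplicity is the order of the zero of $\det T(z)$ at $\lambda$, and eigenvalues are counted with multiplicity. $|E(z)|$ is the matrix of absolute values of the entries of $E(z)$, and $\|\cdot\|_2$ is the Euclidean vector norm or the spectral matrix norm it induces. The matrix $V$ is invertible with columns $v_1,\dots,v_n$ satisfying $Av_i=\lambda_i v_i$, and $w_i^*$ denotes the $i$th row of $V^{-1}$, so $w_i^*A=\lambda_i w_i^*$ and $w_i^*v_i=1$. The angle $\theta_i\in[0,\pi/2)$ is defined by $\cos\theta_i = |w_i^*v_i|/(\|w_i\|_2\|v_i\|_2)$, so $\sec\theta_i=\|w_i\|_2\|v_i\|_2/|w_i^*v_i|$. *)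

theory Defs
  imports "HOL-Complex_Analysis.Complex_Analysis"
begin

text \<open>
  Matrix-valued functions are total in HOL; everything below looks at them only on the open
  domain \<open>\<Omega>\<close> on which they are given.
\<close>

definition matrix_analytic_on :: "(complex \<Rightarrow> complex^'n^'m) \<Rightarrow> complex set \<Rightarrow> bool" where
  "matrix_analytic_on E \<Omega> \<longleftrightarrow> (\<forall>i j. (\<lambda>z. E z $ i $ j) analytic_on \<Omega>)"

definition regular_on :: "(complex \<Rightarrow> complex^'n^'n) \<Rightarrow> complex set \<Rightarrow> bool" where
  "regular_on T \<Omega> \<longleftrightarrow> (\<exists>z\<in>\<Omega>. det (T z) \<noteq> 0)"

definition nl_eigenvalues :: "(complex \<Rightarrow> complex^'n^'n) \<Rightarrow> complex set \<Rightarrow> complex set" where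
  "nl_eigenvalues T \<Omega> = {z \<in> \<Omega>. \<not> invertible (T z)}"

text \<open>
  At an eigenvalue of a regular analytic \<open>T\<close> on a domain, \<open>zorder\<close> is the positive order of the
  zero of the determinant, so the conversion from \<open>int\<close> loses nothing.
\<close>

definition nl_multiplicity :: "(complex \<Rightarrow> complex^'n^'n) \<Rightarrow> complex \<Rightarrow> nat" where
  "nl_multiplicity T z = nat (zorder (\<lambda>u. det (T u)) z)"

definition has_eigenvalue_count ::
    "(complex \<Rightarrow> complex^'n^'n) \<Rightarrow> complex set \<Rightarrow> complex set \<Rightarrow> nat \<Rightarrow> bool" where
  "has_eigenvalue_count T \<Omega> U k \<longleftrightarrow>
     finite (nl_eigenvalues T \<Omega> \<inter> U) \<and>
     (\<Sum>z \<in> nl_eigenvalues T \<Omega> \<inter> U. nl_multiplicity T z) = k"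

definition abs_matrix :: "complex^'n^'m \<Rightarrow> real^'n^'m" where
  "abs_matrix M = (\<chi> i j. cmod (M $ i $ j))"

text \<open>The operator norm induced by the Euclidean norm, which is \<open>norm\<close> on \<open>real^'n\<close>.\<close>

definition spectral_norm :: "real^'n^'m \<Rightarrow> real" where
  "spectral_norm M = onorm (\<lambda>x. M *v x)"

definition cdot :: "complex^'n \<Rightarrow> complex^'n \<Rightarrow> complex" where
  "cdot w v = (\<Sum>j\<in>UNIV. cnj (w $ j) * v $ j)"

text \<open>
  The vector \<open>w\<^sub>i\<close> whose conjugate transpose is row \<open>i\<close> of the inverse of \<open>V\<close>; hence the
  conjugation.
\<close>

definition left_eigenvector :: "complex^'n^'n \<Rightarrow> 'n \<Rightarrow> complex^'n" where
  "left_eigenvector V i = (\<chi> j. cnj (row i (matrix_inv V) $ j))"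

text \<open>
  The argument of \<open>arccos\<close> is nonnegative, so for vectors with \<open>cdot w v \<noteq> 0\<close> the angle lies in
  \<open>[0, pi/2)\<close>.
\<close>

definition vec_angle :: "complex^'n \<Rightarrow> complex^'n \<Rightarrow> real" where
  "vec_angle w v = arccos (cmod (cdot w v) / (norm w * norm v))"

definition disk_radius :: "real^'n^'n \<Rightarrow> complex^'n^'n \<Rightarrow> 'n \<Rightarrow> real" where
  "disk_radius F V i =
     real CARD('n) * spectral_norm F * (1 / cos (vec_angle (left_eigenvector V i) (column i V)))"

end

theory Submission
  imports Defs
begin

text \<open>
  In the eigenbasis of \<open>A\<close> the matrix \<open>A - z I\<close> is diagonal, and a Gershgorin argument for the
  perturbation \<open>E z\<close> in these coordinates shows that \<open>A - z I + E z\<close> can be singular only if \<open>z\<close>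
  lies in one of the disks (\<open>singular_perturbation_in_disks\<close>). The argument uses only the bound
  \<open>F\<close> on the entries of the perturbation, so it applies equally to \<open>s E z\<close> for all \<open>s\<close> between
  \<open>0\<close> and \<open>1\<close>.

  For the count, consider the determinants of \<open>A - z I + s E z\<close> as a homotopy. During the whole
  homotopy the zeros stay in the disks, and zeros in the compact set \<open>U\<close> are separated from
  those in the other disks. The number of zeros in \<open>U\<close> is therefore constant along the homotopy
  (\<open>zero_count_homotopy_invariant\<close>). At \<open>s = 0\<close> the determinant is the product of the factors
  \<open>ev i - z\<close>, and its zeros in \<open>U\<close>, with multiplicity, are the centres of the chosen disks.
  At \<open>s = 1\<close> they are the eigenvalues of \<open>T\<close>.

  The union \<open>U\<close> may be disconnected and may enclose other disks, so no single contour
  surrounds exactly \<open>U\<close>. Invariance of the count is obtained instead from Rouche's theorem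
  on small disks around the individual zeros (\<open>zero_count_locally_constant\<close>) and from the
  connectedness of the parameter interval.
\<close>

(* Formal power series also use the infix $; here it always selects a component. *)
unbundle no fps_syntax

section \<open>Eigenvalues of a perturbed diagonalizable matrix\<close>

lemma matrix_inv_left_right:
  fixes V :: "'a::semiring_1^'n^'m"
  assumes "invertible V"
  shows "V ** matrix_inv V = mat 1" "matrix_inv V ** V = mat 1"
  using someI_ex[of "\<lambda>A'. V ** A' = mat 1 \<and> A' ** V = mat 1"] assms
  unfolding invertible_def matrix_inv_def by auto

text \<open>
  Entrywise domination gives domination of operator norms: applying \<open>G\<close> to \<open>x\<close> is bounded
  entry by entry by applying \<open>F\<close> to the vector of moduli of \<open>x\<close>, and passing to moduli does not
  change the Euclidean norm.
\<close>

lemma norm_matrix_vector_mult_le_spectral_norm: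
  fixes G :: "complex^'n^'m" and F :: "real^'n^'m"
  assumes "abs_matrix G \<le> F"
  shows "norm (G *v x) \<le> spectral_norm F * norm x"
proof -
  let ?a = "(\<chi> j. cmod (x $ j)) :: real^'n"
  have GF: "cmod (G $ i $ j) \<le> F $ i $ j" for i j
    using assms by (auto simp: less_eq_vec_def abs_matrix_def)
  have entry: "cmod ((G *v x) $ i) \<le> (F *v ?a) $ i" for i
  proof -
    have "cmod ((G *v x) $ i) \<le> (\<Sum>j\<in>UNIV. cmod (G $ i $ j * x $ j))"
      unfolding matrix_vector_mult_def by (simp add: norm_sum)
    also have "\<dots> \<le> (\<Sum>j\<in>UNIV. F $ i $ j * cmod (x $ j))"
      by (intro sum_mono) (simp add: norm_mult GF mult_right_mono)
    finally show ?thesis by (simp add: matrix_vector_mult_def)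
  qed
  have "norm (G *v x) \<le> norm (F *v ?a)"
    unfolding norm_vec_def
  proof (rule L2_set_mono)
    show "cmod ((G *v x) $ i) \<le> norm ((F *v ?a) $ i)" for i
      using entry[of i] by simp
  qed simp
  also have "\<dots> \<le> spectral_norm F * norm ?a"
    unfolding spectral_norm_def by (rule onorm) simp
  also have "norm ?a = norm x"
    by (simp add: norm_vec_def)
  finally show ?thesis .
qed

lemma norm_bilinear_sum_le:
  fixes w v :: "complex^'n"
  shows "cmod (\<Sum>j\<in>UNIV. w $ j * v $ j) \<le> norm w * norm v"
proof -
  have "cmod (\<Sum>j\<in>UNIV. w $ j * v $ j) \<le> (\<Sum>j\<in>UNIV. cmod (w $ j * v $ j))"
    by (rule norm_sum)
  also have "\<dots> = (\<Sum>j\<in>UNIV. \<bar>cmod (w $ j)\<bar> * \<bar>cmod (v $ j)\<bar>)"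
    by (simp add: norm_mult)
  also have "\<dots> \<le> norm w * norm v"
    unfolding norm_vec_def by (rule L2_set_mult_ineq)
  finally show ?thesis .
qed

text \<open>
  Row \<open>i\<close> of the inverse times column \<open>i\<close> of \<open>V\<close> is \<open>1\<close>, so the secant of the angle is the
  plain product of the two norms. By Cauchy-Schwarz that product is at least \<open>1\<close>, which puts its
  reciprocal into the range where \<open>cos\<close> inverts \<open>arccos\<close>.
\<close>

lemma disk_radius_eq:
  fixes V :: "complex^'n^'n"
  assumes "invertible V"
  shows "disk_radius F V i =
    real CARD('n) * spectral_norm F * (norm (row i (matrix_inv V)) * norm (column i V))"
proof -
  let ?w = "row i (matrix_inv V)" and ?v = "column i V"
  have "(\<Sum>j\<in>UNIV. ?w $ j * ?v $ j) = (matrix_inv V ** V) $ i $ i"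
    by (simp add: matrix_matrix_mult_def row_def column_def)
  then have one: "(\<Sum>j\<in>UNIV. ?w $ j * ?v $ j) = 1"
    using matrix_inv_left_right[OF assms] by (simp add: mat_def)
  then have ge: "1 \<le> norm ?w * norm ?v"
    using norm_bilinear_sum_le[of ?w ?v] by simp
  have nw: "norm (left_eigenvector V i) = norm ?w"
    by (simp add: norm_vec_def left_eigenvector_def)
  have "cdot (left_eigenvector V i) ?v = 1"
    using one by (simp add: cdot_def left_eigenvector_def)
  then have "cos (vec_angle (left_eigenvector V i) ?v) = 1 / (norm ?w * norm ?v)"
    unfolding vec_angle_def using ge by (subst cos_arccos) (auto simp: nw field_simps)
  then show ?thesis
    by (simp add: disk_radius_def)
qed

lemma disk_radius_nonneg:
  fixes V :: "complex^'n^'n"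
  assumes "invertible V"
  shows "0 \<le> disk_radius F V i"
  unfolding disk_radius_eq[OF assms] spectral_norm_def
  by (intro mult_nonneg_nonneg onorm_pos_le) auto

lemma eigenbasis_diagonalizes:
  fixes A V :: "'a::field^'n^'n"
  assumes "\<And>i. A *v column i V = ev i *s column i V"
  shows "A ** V = V ** (\<chi> i j. if i = j then ev i else 0)"
proof -
  have "(A ** V) $ i $ j = V $ i $ j * ev j" for i j
    using arg_cong[OF assms[of j], of "\<lambda>x. x $ i"]
    by (simp add: matrix_matrix_mult_def matrix_vector_mult_def column_def mult.commute)
  then show ?thesis
    by (simp add: vec_eq_iff matrix_matrix_mult_def if_distrib cong: if_cong)
qed

text \<open>
  A weighted Gershgorin argument. Let \<open>x\<close> be a null vector and \<open>y\<close> its coordinates in the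
  eigenbasis. In these coordinates \<open>A\<close> is diagonal, so coordinate \<open>i\<close> of the null vector equation
  says that \<open>(z - ev i) * y $ i\<close> is row \<open>i\<close> of \<open>matrix_inv V\<close> applied to \<open>G *v x\<close>, and
  Cauchy-Schwarz bounds it by the norm of that row times the spectral norm of \<open>F\<close> times
  the norm of \<open>x\<close>. Take for \<open>i\<close> the index whose term \<open>y $ i *s column i V\<close> in the expansion of \<open>x\<close>
  is the longest: then the norm of \<open>x\<close> is at most \<open>n\<close> times the length of this term, and
  cancelling the modulus of \<open>y $ i\<close> leaves exactly the radius of disk \<open>i\<close>.
\<close>

lemma singular_perturbation_in_disks:
  fixes A V G :: "complex^'n^'n" and F :: "real^'n^'n"
  assumes V: "invertible V" and ev: "\<And>i. A *v column i V = ev i *s column i V"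
    and G: "abs_matrix G \<le> F" and sing: "\<not> invertible (A - mat z + G)"
  shows "\<exists>i. z \<in> cball (ev i) (disk_radius F V i)"
proof -
  let ?W = "matrix_inv V" and ?D = "(\<chi> i j. if i = j then ev i else 0) :: complex^'n^'n"
  obtain x where x: "x \<noteq> 0" "(A - mat z + G) *v x = 0"
    using sing unfolding invertible_left_inverse matrix_left_invertible_ker by blast
  define y where "y = ?W *v x"
  note W = matrix_inv_left_right[OF V]
  have Vy: "V *v y = x"
    by (simp add: y_def matrix_vector_mul_assoc W)
  have "?W ** A = ?W ** (A ** V) ** ?W"
    by (simp add: matrix_mul_assoc[symmetric] W)
  also have "\<dots> = ?D ** ?W"
    unfolding eigenbasis_diagonalizes[OF ev] by (simp add: matrix_mul_assoc W)
  finally have WA: "?W ** A = ?D ** ?W" .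
  have row_eq: "(?W *v (G *v x)) $ i = (z - ev i) * y $ i" for i
  proof -
    have "mat z *v x = z *s x"
      by (simp add: vec_eq_iff matrix_vector_mult_def mat_def if_distrib if_distribR cong: if_cong)
    then have "G *v x = (A - mat z + G) *v x - (A *v x - z *s x)"
      by (simp add: matrix_vector_mult_add_rdistrib matrix_vector_mult_diff_rdistrib)
    then have "?W *v (G *v x) = ?W *v (z *s x) - ?W *v (A *v x)"
      by (simp add: x(2) matrix_vector_mult_diff_distrib)
    also have "?W *v (A *v x) = ?D *v y"
      unfolding y_def matrix_vector_mul_assoc WA ..
    also have "?W *v (z *s x) = z *s y"
      by (simp add: y_def vector_scalar_commute)
    finally have "?W *v (G *v x) = z *s y - ?D *v y" .
    moreover have "(?D *v y) $ i = ev i * y $ i"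
      by (simp add: matrix_vector_mult_def if_distrib if_distribR cong: if_cong)
    ultimately show ?thesis
      by (simp add: left_diff_distrib)
  qed
  \<comment> \<open>the lengths of the terms in the expansion of \<open>x\<close> in the eigenbasis\<close>
  define q where "q = (\<lambda>j. cmod (y $ j) * norm (column j V))"
  have "Max (range q) \<in> range q" by (rule Max_in) auto
  then obtain i where qi: "Max (range q) = q i" by (rule rangeE)
  have i: "q j \<le> q i" for j
    unfolding qi[symmetric] by (rule Max_ge) auto
  have "norm x \<le> (\<Sum>j\<in>UNIV. norm (y $ j *s column j V))"
    unfolding Vy[symmetric] matrix_mult_sum by (rule norm_sum)
  also have "\<dots> = (\<Sum>j\<in>UNIV. q j)"
    by (simp add: q_def norm_vec_def norm_mult L2_set_right_distrib)
  also have "\<dots> \<le> real CARD('n) * q i"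
    using sum_bounded_above[of UNIV q "q i"] i by simp
  finally have nx: "norm x \<le> real CARD('n) * q i" .
  have "y $ i \<noteq> 0"
  proof
    assume "y $ i = 0"
    then have "norm x \<le> 0" using nx by (simp add: q_def)
    then show False using x(1) by simp
  qed
  have F0: "0 \<le> spectral_norm F"
    unfolding spectral_norm_def by (rule onorm_pos_le) simp
  have "norm (G *v x) \<le> spectral_norm F * norm x"
    by (rule norm_matrix_vector_mult_le_spectral_norm[OF G])
  also have "\<dots> \<le> spectral_norm F * (real CARD('n) * q i)"
    by (rule mult_left_mono[OF nx F0])
  finally have nG: "norm (G *v x) \<le> spectral_norm F * (real CARD('n) * q i)" .
  have "cmod (z - ev i) * cmod (y $ i) = cmod (\<Sum>j\<in>UNIV. row i ?W $ j * (G *v x) $ j)"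
    unfolding norm_mult[symmetric] row_eq[symmetric]
    by (simp add: row_def matrix_vector_mult_def)
  also have "\<dots> \<le> norm (row i ?W) * norm (G *v x)"
    by (rule norm_bilinear_sum_le)
  also have "\<dots> \<le> norm (row i ?W) * (spectral_norm F * (real CARD('n) * q i))"
    by (rule mult_left_mono[OF nG norm_ge_zero])
  also have "\<dots> = disk_radius F V i * cmod (y $ i)"
    by (simp add: disk_radius_eq[OF V] q_def)
  finally have "cmod (z - ev i) \<le> disk_radius F V i"
    using \<open>y $ i \<noteq> 0\<close> by simp
  then show ?thesis
    by (auto simp: dist_norm norm_minus_commute)
qed

lemma det_shift_eq_prod:
  fixes A V :: "'a::field^'n^'n"
  assumes V: "invertible V" and ev: "\<And>i. A *v column i V = ev i *s column i V"
  shows "det (A - mat z) = (\<Prod>i\<in>UNIV. ev i - z)"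
proof -
  let ?D = "(\<chi> i j. if i = j then ev i else 0) :: 'a^'n^'n"
  have "mat z ** V = V ** mat z"
    by (simp add: vec_eq_iff matrix_matrix_mult_def mat_def if_distrib if_distribR mult.commute
        cong: if_cong)
  moreover have "(A - mat z) ** V = A ** V - mat z ** V"
    by (simp add: vec_eq_iff matrix_matrix_mult_def left_diff_distrib sum_subtractf)
  moreover have "V ** (?D - mat z) = V ** ?D - V ** mat z"
    by (simp add: vec_eq_iff matrix_matrix_mult_def right_diff_distrib sum_subtractf)
  ultimately have "(A - mat z) ** V = V ** (?D - mat z)"
    by (simp only: eigenbasis_diagonalizes[OF ev])
  then have "det ((A - mat z) ** V) = det (V ** (?D - mat z))"
    by (rule arg_cong)
  then have "det (A - mat z) * det V = det V * det (?D - mat z)"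
    by (simp only: det_mul)
  moreover have "det V \<noteq> 0"
    using V by (simp add: invertible_det_nz)
  moreover have "det (?D - mat z) = (\<Prod>i\<in>UNIV. ev i - z)"
    by (subst det_diagonal) (auto simp: mat_def)
  ultimately show ?thesis by simp
qed

lemma holomorphic_on_det:
  fixes M :: "complex \<Rightarrow> complex^'n^'n"
  assumes "\<And>i j. (\<lambda>z. M z $ i $ j) holomorphic_on S"
  shows "(\<lambda>z. det (M z)) holomorphic_on S"
  unfolding det_def by (intro holomorphic_intros assms)

lemma continuous_on_det:
  fixes M :: "'a::topological_space \<Rightarrow> 'b::{comm_ring_1,real_normed_algebra}^'n^'n"
  assumes "\<And>i j. continuous_on S (\<lambda>x. M x $ i $ j)"
  shows "continuous_on S (\<lambda>x. det (M x))"
  unfolding det_def by (intro continuous_intros assms)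

section \<open>Counting zeros along a homotopy\<close>

lemma finite_zeros_on_compact:
  assumes f: "f holomorphic_on S" "open S" "connected S"
    and K: "compact K" "K \<subseteq> S" and nz: "b \<in> S" "f b \<noteq> 0"
  shows "finite {z \<in> K. f z = 0}"
proof (cases "f constant_on S")
  case True
  then have "{z \<in> K. f z = 0} = {}"
    using nz K(2) unfolding constant_on_def by force
  then show ?thesis by (simp only: finite.emptyI)
next
  case False
  then show ?thesis
    by (rule holomorphic_compact_finite_zeros[OF f K])
qed

text \<open>
  Rouche's theorem weights the zeros by winding numbers. For a circle these are \<open>1\<close> inside and
  \<open>0\<close> outside, so they disappear from the count. The functions are given on a larger ball because
  the theorem needs an open set around the circle in which there are only finitely many zeros;
  a ball of intermediate radius \<open>s\<close> is such a set.
\<close>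

lemma Rouche_ball:
  assumes f: "f holomorphic_on ball a R" and g: "g holomorphic_on ball a R"
    and r: "0 < r" "r < R"
    and less: "\<And>z. z \<in> sphere a r \<Longrightarrow> cmod (g z - f z) < cmod (f z)"
  shows "finite {z \<in> ball a r. g z = 0}"
    and "(\<Sum>z | z \<in> ball a r \<and> g z = 0. zorder g z) = (\<Sum>z | z \<in> ball a r \<and> f z = 0. zorder f z)"
proof -
  define s where "s = (r + R) / 2"
  have s: "r < s" "s < R" "0 < s" using r by (auto simp: s_def)
  let ?b = "a + of_real r"
  have b: "?b \<in> sphere a r" "?b \<in> ball a R"
    using r by (auto simp: dist_norm)
  have nz: "f ?b \<noteq> 0" "g ?b \<noteq> 0"
    using less[OF b(1)] by auto
  have "cball a s \<subseteq> ball a R" using s by auto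
  then have zeros_cball: "finite {z \<in> cball a s. f z = 0}" "finite {z \<in> cball a s. g z = 0}"
    by (intro finite_zeros_on_compact[OF f _ _ _ _ b(2) nz(1)]
        finite_zeros_on_compact[OF g _ _ _ _ b(2) nz(2)]; simp)+
  have fin: "finite {z \<in> ball a s. f z = 0}" "finite {z \<in> ball a s. g z = 0}"
    by (rule finite_subset[OF _ zeros_cball(1)], auto)
      (rule finite_subset[OF _ zeros_cball(2)], auto)
  show "finite {z \<in> ball a r. g z = 0}"
    by (rule finite_subset[OF _ fin(2)]) (use s in auto)
  have sub: "ball a s \<subseteq> ball a R" using s by auto
  have out: "winding_number (circlepath a r) z = 0" if "z \<notin> cball a r" for z
    using r that
    by (intro winding_number_zero_outside[of _ "cball a r"]) (auto simp: path_image_circlepath)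
  have ins: "winding_number (circlepath a r) z = 1" if "z \<in> ball a r" for z
    using that by (intro winding_number_circlepath) (auto simp: dist_norm norm_minus_commute)
  \<comment> \<open>the circle itself has to be free of zeros, since the winding number is undefined there\<close>
  have count: "(\<Sum>p\<in>{p \<in> ball a s. h p = 0}. winding_number (circlepath a r) p * zorder h p) =
      of_int (\<Sum>z | z \<in> ball a r \<and> h z = 0. zorder h z)"
    if h: "\<And>z. z \<in> sphere a r \<Longrightarrow> h z \<noteq> 0" and finh: "finite {p \<in> ball a s. h p = 0}"
    for h
  proof -
    have "(\<Sum>p\<in>{p \<in> ball a s. h p = 0}. winding_number (circlepath a r) p * zorder h p) =
        (\<Sum>p\<in>{p \<in> ball a r. h p = 0}. winding_number (circlepath a r) p * zorder h p)"
    proof (rule sum.mono_neutral_right[OF finh])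
      show "{p \<in> ball a r. h p = 0} \<subseteq> {p \<in> ball a s. h p = 0}"
        using s by auto
      show "\<forall>p\<in>{p \<in> ball a s. h p = 0} - {p \<in> ball a r. h p = 0}.
          winding_number (circlepath a r) p * of_int (zorder h p) = 0"
      proof
        fix p assume p: "p \<in> {p \<in> ball a s. h p = 0} - {p \<in> ball a r. h p = 0}"
        then have "p \<notin> sphere a r" using h by auto
        then have "p \<notin> cball a r" using p by auto
        then show "winding_number (circlepath a r) p * of_int (zorder h p) = 0"
          by (simp add: out)
      qed
    qed
    also have "\<dots> = (\<Sum>p\<in>{p \<in> ball a r. h p = 0}. of_int (zorder h p))"
      by (intro sum.cong) (auto simp: ins)
    finally show ?thesis by simp
  qed
  have "(\<Sum>p\<in>{p \<in> ball a s. f p + (g p - f p) = 0}.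
        winding_number (circlepath a r) p * zorder (\<lambda>p. f p + (g p - f p)) p) =
      (\<Sum>p\<in>{p \<in> ball a s. f p = 0}. winding_number (circlepath a r) p * zorder f p)"
  proof (rule Rouche_theorem)
    show "finite {p \<in> ball a s. f p + (g p - f p) = 0}" using fin by simp
    show "f holomorphic_on ball a s" "(\<lambda>p. g p - f p) holomorphic_on ball a s"
      using holomorphic_on_subset[OF f sub] holomorphic_on_subset[OF g sub]
      by (auto intro: holomorphic_intros)
    show "path_image (circlepath a r) \<subseteq> ball a s"
      using s r by auto
    show "\<forall>z\<in>path_image (circlepath a r). cmod (g z - f z) < cmod (f z)"
      using less r by auto
    show "\<forall>z. z \<notin> ball a s \<longrightarrow> winding_number (circlepath a r) z = 0"
      using s by (auto intro!: out)
  qed (use fin in auto)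
  moreover have "f z \<noteq> 0" "g z \<noteq> 0" if "z \<in> sphere a r" for z
    using less[OF that] by auto
  ultimately have "complex_of_int (\<Sum>z | z \<in> ball a r \<and> g z = 0. zorder g z) =
      of_int (\<Sum>z | z \<in> ball a r \<and> f z = 0. zorder f z)"
    using count[of f] count[of g] fin by simp
  then show "(\<Sum>z | z \<in> ball a r \<and> g z = 0. zorder g z) = (\<Sum>z | z \<in> ball a r \<and> f z = 0. zorder f z)"
    by (simp only: of_int_eq_iff)
qed

lemma finite_uniform_separation:
  fixes Z :: "'a::metric_space set"
  assumes "finite Z" "open W" "Z \<subseteq> W"
  obtains d where "0 < d" "\<And>a. a \<in> Z \<Longrightarrow> ball a d \<subseteq> W"
    "\<And>a b. a \<in> Z \<Longrightarrow> b \<in> Z \<Longrightarrow> a \<noteq> b \<Longrightarrow> d \<le> dist a b"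
proof -
  have "\<exists>d>0. ball a d \<subseteq> W \<and> (\<forall>b\<in>Z. b \<noteq> a \<longrightarrow> d \<le> dist a b)" if "a \<in> Z" for a
  proof -
    have "a \<in> W"
      by (rule subsetD[OF assms(3) that])
    then obtain d1 where d1: "0 < d1" "ball a d1 \<subseteq> W"
      by (rule openE[OF assms(2)])
    obtain d2 where d2: "0 < d2" "\<forall>b\<in>Z. b \<noteq> a \<longrightarrow> d2 \<le> dist a b"
      using finite_set_avoid[OF assms(1), of a] by auto
    show ?thesis
    proof (intro exI[of _ "min d1 d2"] conjI ballI impI)
      show "ball a (min d1 d2) \<subseteq> W"
        using d1(2) by auto
      show "min d1 d2 \<le> dist a b" if "b \<in> Z" "b \<noteq> a" for b
        using bspec[OF d2(2) that(1)] that(2) by simp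
    qed (use d1 d2 in simp)
  qed
  then obtain D where D: "\<And>a. a \<in> Z \<Longrightarrow>
      0 < D a \<and> ball a (D a) \<subseteq> W \<and> (\<forall>b\<in>Z. b \<noteq> a \<longrightarrow> D a \<le> dist a b)"
    by metis
  \<comment> \<open>the extra element 1 only covers the case of empty \<open>Z\<close>\<close>
  define d where "d = Min (insert 1 (D ` Z))"
  have dD: "d \<le> D a" if "a \<in> Z" for a
    using that assms(1) by (simp add: d_def)
  show thesis
  proof (rule that[of d])
    show "0 < d"
      using assms(1) D by (simp add: d_def)
    show "ball a d \<subseteq> W" if "a \<in> Z" for a
      using subset_ball[OF dD[OF that], of a] D[OF that] by blast
    show "d \<le> dist a b" if "a \<in> Z" "b \<in> Z" "a \<noteq> b" for a b
      using dD[OF that(1)] D[OF that(1)] that(2,3) by fastforce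
  qed
qed

text \<open>
  The confinement of all zeros to one compact set \<open>U\<close> keeps zeros from escaping through the boundary
  of \<open>W\<close>. Surround each zero of \<open>H p\<close> by a small disk, all disks disjoint. Off these disks,
  \<open>U\<close> is a compact set on which \<open>H p\<close> has no zeros, and the same holds for the bounding circles;
  so for parameters near \<open>p\<close> the function \<open>H s\<close> stays uniformly close to \<open>H p\<close> on their
  union \<open>C\<close> and does not vanish there either. All its zeros therefore lie in the small disks, and
  Rouche's theorem says that each disk keeps its number. Small disks around the zeros
  work for every shape of \<open>U\<close>, also when \<open>U\<close> has holes.
\<close>

lemma zero_count_locally_constant:
  fixes H :: "'p::metric_space \<Rightarrow> complex \<Rightarrow> complex"
  assumes W: "open W" and U: "compact U" "U \<subseteq> W"
    and cont: "continuous_on (P \<times> W) (\<lambda>(s, z). H s z)"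
    and hol: "\<And>s. s \<in> P \<Longrightarrow> H s holomorphic_on W"
    and zeros: "\<And>s z. s \<in> P \<Longrightarrow> z \<in> W \<Longrightarrow> H s z = 0 \<Longrightarrow> z \<in> U"
    and fin: "finite {z \<in> W. H p z = 0}" and p: "p \<in> P"
  shows "\<forall>\<^sub>F s in at p within P.
    (\<Sum>z | z \<in> W \<and> H p z = 0. zorder (H p) z) = (\<Sum>z | z \<in> W \<and> H s z = 0. zorder (H s) z)"
proof -
  define Z where "Z = {z \<in> W. H p z = 0}"
  have "finite Z" "Z \<subseteq> W" using fin by (auto simp: Z_def)
  then obtain d where d: "0 < d" "\<And>a. a \<in> Z \<Longrightarrow> ball a d \<subseteq> W"
      "\<And>a b. a \<in> Z \<Longrightarrow> b \<in> Z \<Longrightarrow> a \<noteq> b \<Longrightarrow> d \<le> dist a b"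
    by (rule finite_uniform_separation[OF _ W]) blast
  \<comment> \<open>half the separation, so that the closed disks of radius \<open>r\<close> stay inside \<open>W\<close> and the
    open ones are disjoint\<close>
  define r where "r = d / 2"
  have r: "0 < r" "r < d" using d(1) by (auto simp: r_def)
  define C where "C = (U - (\<Union>a\<in>Z. ball a r)) \<union> (\<Union>a\<in>Z. sphere a r)"
  have "compact C"
    unfolding C_def using \<open>finite Z\<close> U(1)
    by (intro compact_Un compact_diff compact_UN open_UN) auto
  have "sphere a r \<subseteq> W" if "a \<in> Z" for a
    using d(2)[OF that] r by (auto simp: subset_iff)
  then have CW: "C \<subseteq> W"
    using U(2) by (auto simp: C_def)
  have pC: "H p z \<noteq> 0" if "z \<in> C" for z
  proof
    assume "H p z = 0"
    then have z: "z \<in> Z" using that CW by (auto simp: Z_def)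
    then have "z \<in> (\<Union>a\<in>Z. ball a r)" using r by (intro UN_I[of z]) auto
    then have "z \<in> (\<Union>a\<in>Z. sphere a r)" using that unfolding C_def by blast
    then obtain a where a: "a \<in> Z" "dist a z = r" by auto
    then have "a \<noteq> z" using r by auto
    then show False using d(3)[OF a(1) z] a r by auto
  qed
  obtain \<delta> where \<delta>: "0 < \<delta>" "\<And>z. z \<in> C \<Longrightarrow> \<delta> < cmod (H p z)"
  proof (cases "C = {}")
    case True
    then show thesis using that[of 1] by auto
  next
    case False
    have "continuous_on C (\<lambda>z. cmod (H p z))"
      by (intro continuous_intros holomorphic_on_imp_continuous_on
          holomorphic_on_subset[OF hol[OF p] CW])
    then obtain z0 where z0: "z0 \<in> C" "\<And>z. z \<in> C \<Longrightarrow> cmod (H p z0) \<le> cmod (H p z)"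
      using continuous_attains_inf[OF \<open>compact C\<close> False] by blast
    have "0 < cmod (H p z0)" using pC[OF z0(1)] by simp
    then have "cmod (H p z0) / 2 < cmod (H p z)" if "z \<in> C" for z
      using z0(2)[OF that] by linarith
    then show thesis
      using that[of "cmod (H p z0) / 2"] \<open>0 < cmod (H p z0)\<close> by auto
  qed
  have "continuous_on (P \<times> C) (\<lambda>(s, z). H s z)"
    by (rule continuous_on_subset[OF cont]) (use CW in auto)
  then obtain X where X: "p \<in> X" "open X" and
      unif: "\<forall>s\<in>X \<inter> P. \<forall>z\<in>C.
        dist ((\<lambda>(s, z). H s z) (s, z)) ((\<lambda>(s, z). H s z) (p, z)) \<le> \<delta>"
    by (rule continuous_on_prod_compactE[OF _ \<open>compact C\<close> p \<delta>(1)])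
  have split: "(\<Sum>z | z \<in> W \<and> H s z = 0. zorder (H s) z) =
      (\<Sum>a\<in>Z. \<Sum>z | z \<in> ball a r \<and> H p z = 0. zorder (H p) z)" if s: "s \<in> X" "s \<in> P" for s
  proof -
    have close: "cmod (H s z - H p z) < cmod (H p z)" if "z \<in> C" for z
    proof -
      have "dist (H s z) (H p z) \<le> \<delta>" using unif s that by auto
      then show ?thesis using \<delta>(2)[OF that] by (simp add: dist_norm)
    qed
    have nz: "H s z \<noteq> 0" if "z \<in> C" for z
      using close[OF that] by auto
    have ballW: "ball a r \<subseteq> W" if "a \<in> Z" for a
      using d(2)[OF that] r by (auto simp: subset_iff)
    have eq: "{z. z \<in> W \<and> H s z = 0} = (\<Union>a\<in>Z. {z \<in> ball a r. H s z = 0})"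
    proof (intro equalityI subsetI)
      fix z assume "z \<in> {z. z \<in> W \<and> H s z = 0}"
      then have z: "z \<in> U" "z \<notin> C" "H s z = 0"
        using zeros[OF s(2)] nz by auto
      then have "z \<in> (\<Union>a\<in>Z. ball a r)" unfolding C_def by blast
      then show "z \<in> (\<Union>a\<in>Z. {z \<in> ball a r. H s z = 0})" using z(3) by blast
    next
      fix z assume "z \<in> (\<Union>a\<in>Z. {z \<in> ball a r. H s z = 0})"
      then show "z \<in> {z. z \<in> W \<and> H s z = 0}" using ballW by blast
    qed
    have R: "finite {z \<in> ball a r. H s z = 0}"
      "(\<Sum>z | z \<in> ball a r \<and> H s z = 0. zorder (H s) z) =
       (\<Sum>z | z \<in> ball a r \<and> H p z = 0. zorder (H p) z)" if "a \<in> Z" for a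
    proof -
      have h: "H s holomorphic_on ball a d" "H p holomorphic_on ball a d"
        using holomorphic_on_subset[OF hol d(2)[OF that]] s(2) p by auto
      have c: "cmod (H s z - H p z) < cmod (H p z)" if "z \<in> sphere a r" for z
        using that \<open>a \<in> Z\<close> by (intro close) (auto simp: C_def)
      show "finite {z \<in> ball a r. H s z = 0}"
        "(\<Sum>z | z \<in> ball a r \<and> H s z = 0. zorder (H s) z) =
         (\<Sum>z | z \<in> ball a r \<and> H p z = 0. zorder (H p) z)"
        using Rouche_ball[OF h(2,1) r c] by auto
    qed
    have disj: "{z \<in> ball a r. H s z = 0} \<inter> {z \<in> ball b r. H s z = 0} = {}"
      if "a \<in> Z" "b \<in> Z" "a \<noteq> b" for a b
    proof -
      have "False" if "dist a z < r" "dist b z < r" for z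
        using d(3)[OF \<open>a \<in> Z\<close> \<open>b \<in> Z\<close> \<open>a \<noteq> b\<close>] dist_triangle2[of a b z] that by (simp add: r_def)
      then show ?thesis by auto
    qed
    have "(\<Sum>z | z \<in> W \<and> H s z = 0. zorder (H s) z) =
        (\<Sum>a\<in>Z. \<Sum>z | z \<in> ball a r \<and> H s z = 0. zorder (H s) z)"
      unfolding eq by (rule sum.UNION_disjoint) (use \<open>finite Z\<close> R(1) disj in auto)
    then show ?thesis using R(2) by simp
  qed
  have "\<forall>\<^sub>F s in at p within P. s \<in> X \<and> s \<in> P"
    using X(1,2) by (auto simp: eventually_at_topological)
  then show ?thesis
    by eventually_elim (use split p X(1) in simp)
qed

lemma zero_count_homotopy_invariant:
  fixes H :: "'p::metric_space \<Rightarrow> complex \<Rightarrow> complex"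
  assumes W: "open W" and U: "compact U" "U \<subseteq> W" and P: "connected P" "p \<in> P" "q \<in> P"
    and cont: "continuous_on (P \<times> W) (\<lambda>(s, z). H s z)"
    and hol: "\<And>s. s \<in> P \<Longrightarrow> H s holomorphic_on W"
    and zeros: "\<And>s z. s \<in> P \<Longrightarrow> z \<in> W \<Longrightarrow> H s z = 0 \<Longrightarrow> z \<in> U"
    and fin: "\<And>s. s \<in> P \<Longrightarrow> finite {z \<in> W. H s z = 0}"
  shows "(\<Sum>z | z \<in> W \<and> H p z = 0. zorder (H p) z) = (\<Sum>z | z \<in> W \<and> H q z = 0. zorder (H q) z)"
proof (rule connected_local_const[OF P(1,2,3), where f = "\<lambda>s. \<Sum>z | z \<in> W \<and> H s z = 0. zorder (H s) z"])
  show "\<forall>s\<in>P. \<forall>\<^sub>F t in at s within P. (\<Sum>z | z \<in> W \<and> H s z = 0. zorder (H s) z) =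
      (\<Sum>z | z \<in> W \<and> H t z = 0. zorder (H t) z)"
    by (intro ballI, rule zero_count_locally_constant[OF W U cont _ _ fin])
      (auto intro: hol zeros)
qed

lemma zorder_prod_linear_factors:
  fixes c :: "'i::finite \<Rightarrow> complex"
  shows "zorder (\<lambda>z. \<Prod>i\<in>UNIV. c i - z) a = int (card {i. c i = a})"
proof -
  have "zorder (\<lambda>z. c i - z) a = (if c i = a then 1 else 0)" for i
  proof (cases "c i = a")
    case True
    then have "zorder (\<lambda>z. c i - z) a = 1"
      by (intro zorder_eqI[of UNIV a "\<lambda>_. -1"]) auto
    then show ?thesis
      using True by simp
  next
    case False
    then show ?thesis
      by (auto intro!: zorder_eq_0I analytic_intros)
  qed
  moreover have "\<forall>\<^sub>F z in at a. (\<Prod>i\<in>UNIV. c i - z) \<noteq> 0"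
  proof -
    have "\<forall>\<^sub>F z in at a. \<forall>i\<in>UNIV. z \<noteq> c i"
      by (intro eventually_ball_finite ballI eventually_neq_at_within) simp
    then show ?thesis by eventually_elim auto
  qed
  ultimately show ?thesis
    by (subst zorder_prod_analytic) (auto intro!: analytic_intros simp: sum.If_cases)
qed

section \<open>Localization and counting of the eigenvalues\<close>

theorem theorem5p3:
  fixes \<Omega> :: "complex set"
    and T E :: "complex \<Rightarrow> complex^'n^'n"
    and A V :: "complex^'n^'n"
    and F :: "real^'n^'n"
    and ev :: "'n \<Rightarrow> complex"
  assumes domain: "open \<Omega>" "connected \<Omega>" "\<Omega> \<noteq> {}" "simply_connected \<Omega>"
    and T: "\<And>z. z \<in> \<Omega> \<Longrightarrow> T z = A - mat z + E z"
    and regular: "regular_on T \<Omega>"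
    and eigenbasis: "invertible V" "\<And>i. A *v column i V = ev i *s column i V"
    and E: "matrix_analytic_on E \<Omega>"
    and bound: "\<And>z. z \<in> \<Omega> \<Longrightarrow> abs_matrix (E z) \<le> F"
  shows "nl_eigenvalues T \<Omega> \<subseteq> (\<Union>i. cball (ev i) (disk_radius F V i)) \<and>
    (\<forall>(K :: 'n set) k U.
       card K = k \<longrightarrow>
       U = (\<Union>i\<in>K. cball (ev i) (disk_radius F V i)) \<longrightarrow>
       (\<forall>j. j \<notin> K \<longrightarrow> U \<inter> cball (ev j) (disk_radius F V j) = {}) \<longrightarrow>
       U \<subseteq> \<Omega> \<longrightarrow>
       has_eigenvalue_count T \<Omega> U k)"
proof -
  define disk where "disk = (\<lambda>i. cball (ev i) (disk_radius F V i))"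
  \<comment> \<open>the homotopy from the characteristic function of \<open>A\<close> to the determinant of \<open>T\<close>\<close>
  define H where "H = (\<lambda>(s::real) z. det (A - mat z + s *\<^sub>R E z))"
  have H0: "H 0 = (\<lambda>z. \<Prod>i\<in>UNIV. ev i - z)"
    using det_shift_eq_prod[OF eigenbasis] by (simp add: H_def)
  have H1: "H 1 z = det (T z)" if "z \<in> \<Omega>" for z
    using T[OF that] by (simp add: H_def)
  have zero_in_disk: "\<exists>i. z \<in> disk i" if "s \<in> {0..1}" "z \<in> \<Omega>" "H s z = 0" for s z
  proof -
    have "abs_matrix (s *\<^sub>R E z) \<le> F"
      unfolding abs_matrix_def less_eq_vec_def
    proof (intro allI)
      fix i j
      have "s * cmod (E z $ i $ j) \<le> 1 * cmod (E z $ i $ j)"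
        using that(1) by (intro mult_right_mono) auto
      also have "\<dots> \<le> F $ i $ j"
        using bound[OF that(2)] by (simp add: abs_matrix_def less_eq_vec_def)
      finally show "(\<chi> i j. cmod ((s *\<^sub>R E z) $ i $ j)) $ i $ j \<le> F $ i $ j"
        using that(1) by simp
    qed
    moreover have "\<not> invertible (A - mat z + s *\<^sub>R E z)"
      using that(3) by (simp add: H_def invertible_det_nz)
    ultimately show ?thesis
      unfolding disk_def by (rule singular_perturbation_in_disks[OF eigenbasis])
  qed
  have eigenvalue_iff: "nl_eigenvalues T \<Omega> = {z \<in> \<Omega>. H 1 z = 0}"
    by (auto simp: nl_eigenvalues_def invertible_det_nz H1)
  have E_hol: "(\<lambda>z. E z $ i $ j) holomorphic_on \<Omega>" for i j
    using E by (simp add: matrix_analytic_on_def analytic_imp_holomorphic)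
  have hol: "H s holomorphic_on \<Omega>" for s
    unfolding H_def
  proof (rule holomorphic_on_det)
    fix i j
    have "(\<lambda>z. (mat z :: complex^'n^'n) $ i $ j) holomorphic_on \<Omega>"
      by (cases "i = j") (auto simp: mat_def)
    then show "(\<lambda>z. (A - mat z + s *\<^sub>R E z) $ i $ j) holomorphic_on \<Omega>"
      by (auto simp: scaleR_conv_of_real intro!: holomorphic_intros E_hol)
  qed
  have cont: "continuous_on ({0..1} \<times> \<Omega>) (\<lambda>(s, z). H s z)"
  proof -
    have E_cont: "continuous_on ({0..1} \<times> \<Omega>) (\<lambda>p. E (snd p) $ i $ j)" for i j
      by (rule continuous_on_compose2[OF holomorphic_on_imp_continuous_on[OF E_hol[of i j]]])
        (auto intro: continuous_intros)
    have mat_cont: "continuous_on ({0..1} \<times> \<Omega>) (\<lambda>p. (mat (snd p) :: complex^'n^'n) $ i $ j)"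
      for i j
      by (cases "i = j") (auto simp: mat_def intro: continuous_intros)
    have "continuous_on ({0..1} \<times> \<Omega>) (\<lambda>p. H (fst p) (snd p))"
      unfolding H_def
    proof (rule continuous_on_det)
      show "continuous_on ({0..1} \<times> \<Omega>) (\<lambda>p. (A - mat (snd p) + fst p *\<^sub>R E (snd p)) $ i $ j)"
        for i j
        unfolding vector_add_component vector_minus_component vector_scaleR_component
        by (intro continuous_on_add continuous_on_diff continuous_on_scaleR continuous_on_const
            continuous_on_fst continuous_on_id mat_cont E_cont)
    qed
    then show ?thesis
      by (simp add: case_prod_unfold)
  qed
  have centre: "ev i \<in> disk i" for i
    using disk_radius_nonneg[OF eigenbasis(1)] by (simp add: disk_def)
  have count: "has_eigenvalue_count T \<Omega> U (card K)"
    if U: "U = (\<Union>i\<in>K. disk i)" and sep: "\<And>j. j \<notin> K \<Longrightarrow> U \<inter> disk j = {}" and sub: "U \<subseteq> \<Omega>"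
    for K :: "'n set" and U
  proof (cases "K = {}")
    case True
    then show ?thesis
      by (simp add: has_eigenvalue_count_def U)
  next
    case False
    \<comment> \<open>the disks that have to be kept out of the count\<close>
    define R where "R = (\<Union>j\<in>-K. disk j)"
    define W where "W = \<Omega> - R"
    have "compact U" "closed R"
      unfolding U R_def disk_def by (auto intro!: compact_UN closed_UN)
    have "U \<inter> R = {}" using sep by (auto simp: R_def)
    have W: "open W" "U \<subseteq> W" "W \<subseteq> \<Omega>"
      using domain(1) \<open>closed R\<close> sub \<open>U \<inter> R = {}\<close> by (auto simp: W_def)
    have "U \<noteq> {}"
      using False centre by (auto simp: U)
    \<comment> \<open>The disks cannot cover \<open>\<Omega>\<close>: by connectedness \<open>U\<close> alone would cover it, but a
      nonempty open set is not compact. At a point outside all disks no \<open>H s\<close>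
      vanishes, so no \<open>H s\<close> is identically zero and each has finitely many zeros in \<open>U\<close>.\<close>
    have "\<not> \<Omega> \<subseteq> U \<union> R"
    proof
      assume cover: "\<Omega> \<subseteq> U \<union> R"
      have "\<Omega> \<inter> R = {}"
        using connected_closedD[OF domain(2), of U R] cover \<open>U \<noteq> {}\<close> \<open>U \<inter> R = {}\<close> sub
          compact_imp_closed[OF \<open>compact U\<close>] \<open>closed R\<close> by auto
      then have "U = \<Omega>" using cover sub by auto
      then show False
        using \<open>compact U\<close> domain(1) \<open>U \<noteq> {}\<close> compact_open[of U] by auto
    qed
    then obtain b where b: "b \<in> \<Omega>" "b \<notin> U" "b \<notin> R" by auto
    then have b_out: "b \<notin> disk i" for i
      by (cases "i \<in> K") (auto simp: U R_def)
    have zeros: "z \<in> U" if "s \<in> {0..1}" "z \<in> W" "H s z = 0" for s z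
      using zero_in_disk[of s z] that W(3) by (auto simp: U W_def R_def)
    have eqU: "{z \<in> W. H s z = 0} = {z \<in> U. H s z = 0}" if "s \<in> {0..1}" for s
      using zeros[OF that] W(2) by auto
    have nz: "H s b \<noteq> 0" if "s \<in> {0..1}" for s
      using zero_in_disk[OF that b(1)] b_out by auto
    have fin: "finite {z \<in> W. H s z = 0}" if "s \<in> {0..1}" for s
      unfolding eqU[OF that]
      by (rule finite_zeros_on_compact[OF hol domain(1,2) \<open>compact U\<close> sub b(1) nz[OF that]])
    have inv: "(\<Sum>z | z \<in> W \<and> H 1 z = 0. zorder (H 1) z) = (\<Sum>z | z \<in> W \<and> H 0 z = 0. zorder (H 0) z)"
    proof (rule zero_count_homotopy_invariant[where P = "{0..1}" and U = U])
      show "continuous_on ({0..1} \<times> W) (\<lambda>(s, z). H s z)"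
        by (rule continuous_on_subset[OF cont]) (use W(3) in auto)
      show "H s holomorphic_on W" for s
        by (rule holomorphic_on_subset[OF hol W(3)])
    qed (use W \<open>compact U\<close> zeros fin in auto)
    have ev_in: "ev i \<in> W \<longleftrightarrow> i \<in> K" for i
      using centre[of i] W(2) by (auto simp: U W_def R_def)
    have "{z \<in> W. H 0 z = 0} = ev ` K"
      using ev_in by (auto simp: H0)
    then have "(\<Sum>z | z \<in> W \<and> H 0 z = 0. zorder (H 0) z) = (\<Sum>z\<in>ev ` K. int (card {i. ev i = z}))"
      by (simp add: H0 zorder_prod_linear_factors)
    also have "\<dots> = int (card (\<Union>z\<in>ev ` K. {i. ev i = z}))"
      by (subst card_UN_disjoint) auto
    also have "(\<Union>z\<in>ev ` K. {i. ev i = z}) = K"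
    proof -
      have "i \<in> K" if "k \<in> K" "ev i = ev k" for i k
        using ev_in[of i] ev_in[of k] that by simp
      then show ?thesis by auto
    qed
    finally have total: "(\<Sum>z | z \<in> W \<and> H 1 z = 0. zorder (H 1) z) = int (card K)"
      using inv by simp
    have eigU: "nl_eigenvalues T \<Omega> \<inter> U = {z \<in> W. H 1 z = 0}"
      using eqU[of 1] sub by (auto simp: eigenvalue_iff)
    have mult: "int (nl_multiplicity T z) = zorder (H 1) z" if "z \<in> W" "H 1 z = 0" for z
    proof -
      have "z \<in> \<Omega>" using that(1) W(3) by auto
      then have "\<forall>\<^sub>F u in at z. u \<in> \<Omega>"
        using domain(1) by (simp add: eventually_at_topological) blast
      then have "\<forall>\<^sub>F u in at z. det (T u) = H 1 u"
        by (rule eventually_mono) (simp add: H1)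
      then have "zorder (\<lambda>u. det (T u)) z = zorder (H 1) z"
        by (rule zorder_cong) simp
      moreover have "0 < zorder (H 1) z"
        using zorder_exist_zero[OF hol[of 1] domain(1,2) \<open>z \<in> \<Omega>\<close>] b(1) nz[of 1] that(2) by auto
      ultimately show ?thesis
        by (simp add: nl_multiplicity_def)
    qed
    have "int (\<Sum>z\<in>nl_eigenvalues T \<Omega> \<inter> U. nl_multiplicity T z) = int (card K)"
      unfolding eigU total[symmetric] of_nat_sum by (intro sum.cong) (auto simp: mult)
    then have "(\<Sum>z\<in>nl_eigenvalues T \<Omega> \<inter> U. nl_multiplicity T z) = card K"
      by (simp only: of_nat_eq_iff)
    then show ?thesis
      using fin[of 1] by (simp add: has_eigenvalue_count_def eigU)
  qed
  have "nl_eigenvalues T \<Omega> \<subseteq> (\<Union>i. disk i)"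
    using zero_in_disk[of 1] by (auto simp: eigenvalue_iff)
  then show ?thesis
    using count unfolding disk_def by blast
qed

end
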